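(* Let $M \colon \bigcup_{n=1}^\infty \mathbb{R}_+^n \to \mathbb{R}_+$ be a homogeneous, symmetric, repetition invariant, and Jensen concave mean on $\mathbb{R}_+$. Then $M$ is a Hardy mean if and only if it is a weak-Hardy mean.
   Context: Here $\mathbb{R}_+=(0,+\infty)$. A mean on $\mathbb{R}_+$ is a function $M \colon \bigcup_{n=1}^\infty \mathbb{R}_+^n \to \mathbb{R}_+$ such that $\min(v)\le M(v)\le \max(v)$ for every vector $v$ in its domain. The mean $M$ is: - homogeneous if $M(tv_1,\dots,tv_n)=t\,M(v_1,\dots,v_n)$ for all $n\in\mathbb{N}$, $t>0$ and $(v_1,\dots,v_n)\in\mathbb{R}_+^n$; - symmetric if for every $n\in\mathbb{N}$ the restriction $M|_{\mathbb{R}_+^n}$ is invariant under all permutations of its $n$ arguments; - Jensen concave if for every $n\in\mathbb{N}$ and all $x,y\in\mathbb{R}_+^n$ one has $M\big(\tfrac{x+y}{2}\big)\ge \tfrac{M(x)+M(y)}{2}$; - repetition invariant if for all $n,m\in\mathbb{N}$ and $(v_1,\dots,v_n)\in \mathbb{R}_+^n$, $$M(\underbrace{v_1,\dots,v_1}_{m\text{ times}},\dots,\underbrace{v_n,\dots,v_n}_{m\text{ times}})=M(v_1,\dots,v_n).$$ Let $\ell_1(\mathbb{R}_+)$ denote the set of sequences $a=(a_n)_{n=1}^\infty$ of elements of $\mathbb{R}_+$ with $\sum_{n=1}^\infty a_n<+\infty$. The mean $M$ is a Hardy mean if there exists a finite constant $C$ such that $$\sum_{n=1}^\infty M(a_1,\dots,a_n)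 \le C \sum_{n=1}^\infty a_n \quad \text{for all } a \in \ell_1(\mathbb{R}_+).$$ The mean $M$ is a weak-Hardy mean if $$\sum_{n=1}^\infty M(a_1,\dots,a_n) < +\infty \quad \text{for all } a \in \ell_1(\mathbb{R}_+).$$ *)

theory Defs
  imports "HOL-Analysis.Analysis" "HOL-Combinatorics.Permutations"
begin

text \<open>
  An element of the disjoint union of the \<open>\<real>\<^sub>+\<^sup>n\<close> over \<open>n \<ge> 1\<close> is a nonempty list of positive
  reals. A mean is represented by a function on all real lists; its values outside
  \<open>pos_vecs\<close> are irrelevant, since every notion below only evaluates it there.
\<close>

definition pos_vecs :: "real list set" where
  "pos_vecs = {v. v \<noteq> [] \<and> (\<forall>x\<in>set v. 0 < x)}"

text \<open>The lower bound makes the values of a mean positive on \<open>pos_vecs\<close>.\<close>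

definition is_mean :: "(real list \<Rightarrow> real) \<Rightarrow> bool" where
  "is_mean M \<longleftrightarrow> (\<forall>v\<in>pos_vecs. Min (set v) \<le> M v \<and> M v \<le> Max (set v))"

definition homogeneous :: "(real list \<Rightarrow> real) \<Rightarrow> bool" where
  "homogeneous M \<longleftrightarrow> (\<forall>v\<in>pos_vecs. \<forall>t>0. M (map (\<lambda>x. t * x) v) = t * M v)"

definition symmetric :: "(real list \<Rightarrow> real) \<Rightarrow> bool" where
  "symmetric M \<longleftrightarrow>
     (\<forall>v\<in>pos_vecs. \<forall>p. p permutes {..<length v} \<longrightarrow> M (permute_list p v) = M v)"

definition jensen_concave :: "(real list \<Rightarrow> real) \<Rightarrow> bool" where
  "jensen_concave M \<longleftrightarrow>
     (\<forall>x\<in>pos_vecs. \<forall>y\<in>pos_vecs. length x = length y \<longrightarrow>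
        M (map2 (\<lambda>s t. (s + t) / 2) x y) \<ge> (M x + M y) / 2)"

definition repetition_invariant :: "(real list \<Rightarrow> real) \<Rightarrow> bool" where
  "repetition_invariant M \<longleftrightarrow>
     (\<forall>v\<in>pos_vecs. \<forall>m\<ge>1. M (concat (map (replicate m) v)) = M v)"

text \<open>
  Sequences are indexed from 0, so \<open>map a [0..<Suc n]\<close> consists of the first \<open>n + 1\<close> terms.
\<close>

definition l1_pos :: "(nat \<Rightarrow> real) set" where
  "l1_pos = {a. (\<forall>n. 0 < a n) \<and> summable a}"

text \<open>
  An inequality of series in \<open>[0, \<infinity>]\<close> with a finite right-hand side includes convergence
  of the left-hand side, which has to be stated separately for real-valued \<open>suminf\<close>.
\<close>

definition hardy_mean :: "(real list \<Rightarrow> real) \<Rightarrow> bool" where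
  "hardy_mean M \<longleftrightarrow>
     (\<exists>C::real. \<forall>a\<in>l1_pos.
        summable (\<lambda>n. M (map a [0..<Suc n])) \<and>
        (\<Sum>n. M (map a [0..<Suc n])) \<le> C * (\<Sum>n. a n))"

definition weak_hardy_mean :: "(real list \<Rightarrow> real) \<Rightarrow> bool" where
  "weak_hardy_mean M \<longleftrightarrow> (\<forall>a\<in>l1_pos. summable (\<lambda>n. M (map a [0..<Suc n])))"

end

theory Submission
  imports Defs
begin

text \<open>
  A homogeneous Jensen concave function is superadditive, so a homogeneous Jensen concave mean
  is monotone: adding a positive vector to the argument adds a positive amount to the value.
  Hence \<open>F a = (\<Sum>n. M (a\<^sub>0, \<dots>, a\<^sub>n))\<close> is a monotone, positively homogeneous functional on the
  positive cone of \<open>\<ell>\<^sub>1\<close>, and for such functionals finiteness everywhere forces boundedness, as in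
  the gliding hump argument. If no Hardy constant exists, there are sequences \<open>a\<^sub>k\<close>, which may be
  scaled to have norm 1, with \<open>F a\<^sub>k > 4\<^sup>k\<close>. The sum \<open>b\<close> of the \<open>2\<^sup>-\<^sup>k a\<^sub>k\<close> is in \<open>\<ell>\<^sub>1\<close> and dominates
  each summand (\<open>exists_summable_dominating\<close>), so \<open>F b \<ge> 2\<^sup>-\<^sup>k F a\<^sub>k > 2\<^sup>k\<close> for every \<open>k\<close>, which
  contradicts the weak Hardy property at the single sequence \<open>b\<close>.
\<close>

lemma prefix_in_pos_vecs:
  assumes "\<And>n. 0 < a n"
  shows "map a [0..<Suc n] \<in> pos_vecs"
  using assms by (auto simp: pos_vecs_def simp del: upt_Suc)

lemma mean_pos:
  assumes "is_mean M" and "v \<in> pos_vecs"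
  shows "0 < M v"
proof -
  have "0 < Min (set v)"
    using assms(2) by (auto simp: pos_vecs_def)
  also have "\<dots> \<le> M v"
    using assms by (auto simp: is_mean_def)
  finally show ?thesis .
qed

lemma homogeneous_scale:
  assumes "homogeneous M" and "map f xs \<in> pos_vecs" and "0 < t"
  shows "M (map (\<lambda>x. t * f x) xs) = t * M (map f xs)"
proof -
  have "M (map (\<lambda>y. t * y) (map f xs)) = t * M (map f xs)"
    using assms unfolding homogeneous_def by blast
  then show ?thesis
    by (simp add: o_def)
qed

text \<open>Apply concavity to the doubled vectors, whose midpoint is the sum.\<close>

lemma superadditive:
  assumes hom: "homogeneous M" and conc: "jensen_concave M"
    and f: "map f xs \<in> pos_vecs" and g: "map g xs \<in> pos_vecs"
  shows "M (map f xs) + M (map g xs) \<le> M (map (\<lambda>x. f x + g x) xs)"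
proof -
  let ?f = "map (\<lambda>x. 2 * f x) xs" and ?g = "map (\<lambda>x. 2 * g x) xs"
  have "?f \<in> pos_vecs" "?g \<in> pos_vecs" "length ?f = length ?g"
    using f g by (auto simp: pos_vecs_def)
  then have "(M ?f + M ?g) / 2 \<le> M (map2 (\<lambda>s t. (s + t) / 2) ?f ?g)"
    using conc unfolding jensen_concave_def by blast
  moreover have "map2 (\<lambda>s t. (s + t) / 2) ?f ?g = map (\<lambda>x. f x + g x) xs"
    by (induction xs) auto
  moreover have "M ?f = 2 * M (map f xs)" "M ?g = 2 * M (map g xs)"
    using homogeneous_scale[OF hom f] homogeneous_scale[OF hom g] by auto
  ultimately show ?thesis
    by simp
qed

lemma mean_mono:
  assumes "is_mean M" and "homogeneous M" and "jensen_concave M"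
    and f: "map f xs \<in> pos_vecs" and less: "\<And>x. x \<in> set xs \<Longrightarrow> f x < g x"
  shows "M (map f xs) \<le> M (map g xs)"
proof -
  have diff: "map (\<lambda>x. g x - f x) xs \<in> pos_vecs"
    using f less by (auto simp: pos_vecs_def)
  have "M (map f xs) + M (map (\<lambda>x. g x - f x) xs) \<le> M (map g xs)"
    using superadditive[OF assms(2,3) f diff] by simp
  with mean_pos[OF assms(1) diff] show ?thesis
    by simp
qed

text \<open>
  The completeness of \<open>\<ell>\<^sub>1\<close> enters here: \<open>b\<close> is the sum of the \<open>2\<^sup>-\<^sup>k a\<^sub>k / \<parallel>a\<^sub>k\<parallel>\<close>, a series of
  elements with summable norms.
\<close>

lemma exists_summable_dominating:
  fixes a :: "nat \<Rightarrow> nat \<Rightarrow> real"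
  assumes a: "\<And>k. a k \<in> l1_pos"
  obtains b where "b \<in> l1_pos" and "\<And>k n. a k n / (2 ^ k * suminf (a k)) < b n"
proof -
  define c where "c k n = a k n / (2 ^ k * suminf (a k))" for k n
  define b where "b n = (\<Sum>k. c k n)" for n
  have pos: "0 < a k n" and summ: "summable (a k)" for k n
    using a by (auto simp: l1_pos_def)
  have S_pos: "0 < suminf (a k)" for k
    using summ pos by (rule suminf_pos)
  have c_pos: "0 < c k n" for k n
    using pos S_pos by (simp add: c_def)
  have partial: "(\<Sum>n<N. c k n) \<le> (1/2) ^ k" for k N
  proof -
    have "(\<Sum>n<N. a k n) \<le> suminf (a k)"
      using summ pos by (intro sum_le_suminf) (auto intro: less_imp_le)
    then show ?thesis
      using S_pos[of k]
      by (simp add: c_def power_one_over divide_simps flip: sum_divide_distrib)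
  qed
  have geom: "summable (\<lambda>k. (1/2 :: real) ^ k)"
    by simp
  have c_summ: "summable (\<lambda>k. c k n)" for n
  proof (rule summable_comparison_test'[OF geom])
    fix k
    have "c k n \<le> (\<Sum>m<Suc n. c k m)"
      using c_pos by (intro member_le_sum) (auto intro: less_imp_le)
    with partial[of k "Suc n"] c_pos[of k n] show "norm (c k n) \<le> (1/2) ^ k"
      by simp
  qed
  have dominates: "c k n < b n" for k n
  proof -
    \<comment> \<open>One further term of the series makes the inequality strict.\<close>
    have "(\<Sum>j\<in>{k, Suc k}. c j n) \<le> b n"
      unfolding b_def using c_summ c_pos
      by (intro sum_le_suminf) (auto intro: less_imp_le)
    with c_pos[of "Suc k" n] show ?thesis
      by simp
  qed
  have b_pos: "0 < b n" for n
    using c_pos[of 0 n] dominates[of 0 n] by simp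
  have "summable b"
  proof (rule summableI_nonneg_bounded)
    show "0 \<le> b n" for n
      using b_pos by (rule less_imp_le)
    fix N
    have "(\<Sum>n<N. b n) = (\<Sum>k. \<Sum>n<N. c k n)"
      unfolding b_def using c_summ by (intro suminf_sum[symmetric])
    also have "\<dots> \<le> (\<Sum>k. (1/2) ^ k)"
      using partial c_summ geom by (intro suminf_le summable_sum)
    finally show "(\<Sum>n<N. b n) \<le> (\<Sum>k. (1/2) ^ k)" .
  qed
  then have "b \<in> l1_pos"
    using b_pos by (simp add: l1_pos_def)
  with dominates show ?thesis
    using that by (simp add: c_def)
qed

theorem proposition4:
  fixes M :: "real list \<Rightarrow> real"
  assumes "is_mean M"
    and "homogeneous M"
    and "symmetric M"
    and "repetition_invariant M"
    and "jensen_concave M"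
  shows "hardy_mean M \<longleftrightarrow> weak_hardy_mean M"
proof
  assume "hardy_mean M"
  then show "weak_hardy_mean M"
    by (auto simp: hardy_mean_def weak_hardy_mean_def)
next
  assume weak: "weak_hardy_mean M"
  define F where "F a = (\<Sum>n. M (map a [0..<Suc n]))" for a
  have F_summ: "summable (\<lambda>n. M (map a [0..<Suc n]))" if "a \<in> l1_pos" for a
    using weak that unfolding weak_hardy_mean_def by blast
  show "hardy_mean M"
  proof (rule ccontr)
    assume "\<not> hardy_mean M"
    then have "\<exists>a\<in>l1_pos. C * suminf a < F a" for C
      using F_summ unfolding hardy_mean_def F_def by (meson not_le)
    then have "\<exists>a. \<forall>k. a k \<in> l1_pos \<and> 4 ^ k * suminf (a k) < F (a k)"
      by (intro choice) blast
    then obtain a where a: "\<And>k. a k \<in> l1_pos"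
      and large: "\<And>k. 4 ^ k * suminf (a k) < F (a k)"
      by blast
    obtain b where b: "b \<in> l1_pos"
      and dominates: "\<And>k n. a k n / (2 ^ k * suminf (a k)) < b n"
      using exists_summable_dominating[of a] a by blast
    have "2 ^ k < F b" for k
    proof -
      define w where "w = 1 / (2 ^ k * suminf (a k))"
      have pos: "0 < a k n" for n
        using a by (auto simp: l1_pos_def)
      have S_pos: "0 < suminf (a k)"
        using a by (intro suminf_pos) (auto simp: l1_pos_def)
      then have w_pos: "0 < w"
        by (simp add: w_def)
      have "w * M (map (a k) [0..<Suc n]) \<le> M (map b [0..<Suc n])" for n
      proof -
        have "w * M (map (a k) [0..<Suc n]) = M (map (\<lambda>i. w * a k i) [0..<Suc n])"
          using homogeneous_scale[OF assms(2) prefix_in_pos_vecs w_pos, of "a k" n] pos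
          by simp
        also have "\<dots> \<le> M (map b [0..<Suc n])"
        proof (rule mean_mono[OF assms(1,2,5)])
          show "map (\<lambda>i. w * a k i) [0..<Suc n] \<in> pos_vecs"
            using pos w_pos by (intro prefix_in_pos_vecs) simp
          show "w * a k i < b i" for i
            using dominates[of k i] by (simp add: w_def)
        qed
        finally show ?thesis .
      qed
      then have "w * F (a k) \<le> F b"
        unfolding F_def suminf_mult[OF F_summ[OF a], symmetric]
        by (intro suminf_le summable_mult F_summ a b)
      moreover have "2 ^ k = w * (4 ^ k * suminf (a k))"
        using S_pos by (simp add: w_def divide_simps flip: power_mult_distrib)
      moreover have "w * (4 ^ k * suminf (a k)) < w * F (a k)"
        using large w_pos by (intro mult_strict_left_mono)
      ultimately show ?thesis
        by simp
    qed
    moreover obtain k where "F b < 2 ^ k"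
      using real_arch_pow[of 2 "F b"] by auto
    ultimately show False
      using less_asym by blast
  qed
qed

end
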